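(* Let $1\le k\le n$, $\lambda_1,\lambda_2,\lambda_3,\lambda_4>0$, and $\mathbf{x}_1,\dots,\mathbf{x}_N\in\mathbb{R}^n$ with empirical measure $\mu_{\rm data}$ (uniform on the $\mathbf{x}_i$, with multiplicity). Let $H(\mathbf{x},\mathbf{y})=\sum_{s=1}^4\frac{\lambda_s}{n^s}(\mathbf{x}\cdot\mathbf{y})^{s-1}$. Consider the following procedure: compute $H_f=\frac1{N^2}\sum_{i,j=1}^N\mathbf{x}_i\mathbf{x}_j^TH(\mathbf{x}_i,\mathbf{x}_j)$; compute its spectral decomposition $H_f=\sum_{i=1}^n\mu_i\mathbf{v}_i\mathbf{v}_i^T$ with orthonormal $\mathbf{v}_i$ and $\mu_1\ge\dots\ge\mu_n$; put $P=\sum_{i=1}^k\mathbf{v}_i\mathbf{v}_i^T$; output the uniform probability measure $\mu'$ on the points $P\mathbf{x}_1,\dots,P\mathbf{x}_N$ (with multiplicity). Then $\mu'$ is a $2$-approximating solution of the problem $\min_{\nu\in\mathcal{P}_k}d_{\rm HM}(\mu_{\rm data},\nu)$; that is, $\mu'\in\mathcal{P}_k$ and $$d_{\rm HM}(\mu_{\rm data},\mu')\ \le\ 2\inf_{\nu\in\mathcal{P}_k}d_{\rm HM}(\mu_{\rm data},\nu).$$ In particular a $2$-approximating solution can be found efficiently.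
   Context: $\mathcal{P}_k$ is the set of Borel probability measures $\mu$ on $\mathbb{R}^n$ for which there exist $\mathbf{v}_1,\dots,\mathbf{v}_k\in\mathbb{R}^n$ with $\mu(A)=\mu(A\cap\operatorname{span}(\mathbf{v}_1,\dots,\mathbf{v}_k))$ for all Borel $A$. The higher-moments distance between probability measures (with the relevant moments finite) is $$d_{\rm HM}(\mu,\nu)^2=\sum_{s=1}^4\frac{\lambda_s}{n^s}\sum_{1\le i_1,\dots,i_s\le n}(m_{i_1\cdots i_s}-n_{i_1\cdots i_s})^2,$$ where $m_{i_1\cdots i_s}=\mathbb{E}_{\mathbf{X}\sim\mu}[X_{i_1}\cdots X_{i_s}]$ and $n_{i_1\cdots i_s}=\mathbb{E}_{\mathbf{X}\sim\nu}[X_{i_1}\cdots X_{i_s}]$. It is the maximum mean discrepancy distance of the kernel $K(\mathbf{x},\mathbf{y})=(\mathbf{x}\cdot\mathbf{y})H(\mathbf{x},\mathbf{y})=\sum_{s=1}^4\frac{\lambda_s}{n^s}(\mathbf{x}\cdot\mathbf{y})^s$. "Efficiently" means by the stated procedure, i.e. by forming the $n\times n$ matrix $H_f$ and computing its top $k$ eigenvectors. *)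

theory Defs
  imports "HOL-Probability.Probability_Measure"
begin

text \<open>The dimension $n$ is \<open>CARD('n)\<close>. Families of vectors, eigenvalues, weights and data points
  are functions on \<open>nat\<close> used only at indices starting from 1.\<close>

definition low_rank_measures :: "nat \<Rightarrow> (real^'n) measure set" where
  "low_rank_measures k = {M. prob_space M \<and> sets M = sets borel \<and>
     (\<exists>v :: nat \<Rightarrow> real^'n. \<forall>A\<in>sets borel. measure M A = measure M (A \<inter> span (v ` {1..k})))}"

text \<open>An index tuple $(i_1,\dots,i_s)$ is a list of length $s$.\<close>

definition monomial :: "'n list \<Rightarrow> real^'n \<Rightarrow> real" where
  "monomial I X = (\<Prod>j<length I. X $ (I ! j))"

definition moment :: "(real^'n) measure \<Rightarrow> 'n list \<Rightarrow> real" where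
  "moment M I = integral\<^sup>L M (monomial I)"

definition finite_moments :: "(real^'n) measure \<Rightarrow> bool" where
  "finite_moments M \<longleftrightarrow> (\<forall>s\<in>{1..4}. \<forall>I. length I = s \<longrightarrow> integrable M (monomial I))"

text \<open>Meaningful only for measures satisfying \<open>finite_moments\<close>: the integral of a
  non-integrable function is 0 by convention.\<close>

definition d_HM :: "(nat \<Rightarrow> real) \<Rightarrow> (real^'n) measure \<Rightarrow> (real^'n) measure \<Rightarrow> real" where
  "d_HM lam M M' = sqrt (\<Sum>s=1..4. lam s / real CARD('n) ^ s *
     (\<Sum>I | length I = s. (moment M I - moment M' I)\<^sup>2))"

definition empirical_measure :: "nat \<Rightarrow> (nat \<Rightarrow> real^'n) \<Rightarrow> (real^'n) measure" where
  "empirical_measure N x = distr (uniform_count_measure {1..N}) borel x"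

definition outer_prod :: "real^'n \<Rightarrow> real^'n \<Rightarrow> real^'n^'n" where
  "outer_prod x y = (\<chi> a b. x $ a * y $ b)"

definition H_kernel :: "(nat \<Rightarrow> real) \<Rightarrow> real^'n \<Rightarrow> real^'n \<Rightarrow> real" where
  "H_kernel lam x y = (\<Sum>s=1..4. lam s / real CARD('n) ^ s * (x \<bullet> y) ^ (s - 1))"

definition H_matrix :: "(nat \<Rightarrow> real) \<Rightarrow> nat \<Rightarrow> (nat \<Rightarrow> real^'n) \<Rightarrow> real^'n^'n" where
  "H_matrix lam N x = (1 / (real N)\<^sup>2) *\<^sub>R
     (\<Sum>i=1..N. \<Sum>j=1..N. H_kernel lam (x i) (x j) *\<^sub>R outer_prod (x i) (x j))"

definition spectral_decomposition ::
    "real^'n^'n \<Rightarrow> (nat \<Rightarrow> real) \<Rightarrow> (nat \<Rightarrow> real^'n) \<Rightarrow> bool" where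
  "spectral_decomposition A mu v \<longleftrightarrow>
     (\<forall>i\<in>{1..CARD('n)}. \<forall>j\<in>{1..CARD('n)}. v i \<bullet> v j = (if i = j then 1 else 0)) \<and>
     antimono_on {1..CARD('n)} mu \<and>
     A = (\<Sum>i=1..CARD('n). mu i *\<^sub>R outer_prod (v i) (v i))"

definition top_projection :: "nat \<Rightarrow> (nat \<Rightarrow> real^'n) \<Rightarrow> real^'n^'n" where
  "top_projection k v = (\<Sum>i=1..k. outer_prod (v i) (v i))"

text \<open>A relation rather than a function, because the spectral decomposition need not be unique.\<close>

definition procedure_output ::
    "(nat \<Rightarrow> real) \<Rightarrow> nat \<Rightarrow> nat \<Rightarrow> (nat \<Rightarrow> real^'n) \<Rightarrow> (real^'n) measure \<Rightarrow> bool" where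
  "procedure_output lam k N x M \<longleftrightarrow>
     (\<exists>mu v. spectral_decomposition (H_matrix lam N x) mu v \<and>
       M = empirical_measure N (\<lambda>i. top_projection k v *v x i))"

text \<open>The infimum is over those members of \<open>low_rank_measures k\<close> for which the
  distance is defined.\<close>

definition approximating_solution ::
    "real \<Rightarrow> (nat \<Rightarrow> real) \<Rightarrow> nat \<Rightarrow> (real^'n) measure \<Rightarrow> (real^'n) measure \<Rightarrow> bool" where
  "approximating_solution c lam k M M' \<longleftrightarrow>
     M' \<in> low_rank_measures k \<and> finite_moments M' \<and>
     d_HM lam M M' \<le> c * (INF M'' \<in> {M'' \<in> low_rank_measures k. finite_moments M''}. d_HM lam M M'')"

end

theory Submission
  imports Defs
begin

text \<open>
  Write $A$ for the matrix \<open>H_matrix lam N x\<close> and $M_s$ for the tensor of $s$-th moments of the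
  data. The kernel is designed so that $A$ is the weighted sum over $s$ of $F_s F_s^T$, where
  $F_s$ is $M_s$ flattened to a matrix with rows indexed by the first tensor index
  (\<open>H_matrix_quadratic_form_moments\<close>). Hence, for an orthogonal projection $Q$, the trace of
  $(I-Q)A$ is the weighted squared norm of what is lost when $Q$ is applied to the first index
  of every $M_s$. Call it the residual of $Q$. Three facts about residuals give the theorem.

  \<^item> A competitor $\nu$ lives on a subspace of dimension at most $k$, say with projection $Q$. Its
    moment tensors are annihilated by $I-Q$ in the first index, so applying the contraction
    $I-Q$ to the difference of the moment tensors shows that the residual of $Q$ is at most
    $d_{\rm HM}(\mu_{\rm data},\nu)^2$ (\<open>residual_le_d_HM_squared\<close>).

  \<^item> Among projections of rank at most $k$, the projection $P$ onto top eigenvectors has the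
    least residual. This is Ky Fan's principle (\<open>Ky_Fan_residual\<close>).

  \<^item> Projecting the data replaces $M_s$ by $P^{\otimes s}M_s$. Changing one of the $s$ indices at
    a time, and using that $M_s$ is symmetric, the squared change is at most $s\le 4$ times the
    contribution of $M_s$ to the residual of $P$
    (\<open>kernel_power_difference_le\<close>, \<open>d_HM_projected_le\<close>).

  So $d_{\rm HM}(\mu_{\rm data},\mu')^2$ is at most $4$ times
  $d_{\rm HM}(\mu_{\rm data},\nu)^2$, and the approximation factor is $\sqrt 4=2$.

  Tensors never appear explicitly. Summing products of monomials over index tuples gives powers
  of inner products (\<open>sum_monomial_mult\<close>), so statements about projected tensors become
  statements about Gram matrices of the data points. That the procedure produces an output at all
  is the spectral theorem for real symmetric matrices (\<open>spectral_decomposition_exists\<close>).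
\<close>

section \<open>Orthonormal families and the spectral theorem\<close>

definition orthonormal_family :: "'i set \<Rightarrow> ('i \<Rightarrow> 'a::real_inner) \<Rightarrow> bool" where
  "orthonormal_family I v \<longleftrightarrow> (\<forall>i\<in>I. \<forall>j\<in>I. v i \<bullet> v j = (if i = j then 1 else 0))"

lemma orthonormal_familyD:
  "orthonormal_family I v \<Longrightarrow> i \<in> I \<Longrightarrow> j \<in> I \<Longrightarrow> v i \<bullet> v j = (if i = j then 1 else 0)"
  by (auto simp: orthonormal_family_def)

lemma orthonormal_family_mono:
  "orthonormal_family I v \<Longrightarrow> J \<subseteq> I \<Longrightarrow> orthonormal_family J v"
  unfolding orthonormal_family_def by blast

lemma orthonormal_combination_inner:
  assumes "orthonormal_family I v" "finite I" "j \<in> I"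
  shows "(\<Sum>i\<in>I. c i *\<^sub>R v i) \<bullet> v j = c j"
proof -
  have "(\<Sum>i\<in>I. c i *\<^sub>R v i) \<bullet> v j = (\<Sum>i\<in>I. if i = j then c i else 0)"
    unfolding inner_sum_left
    by (intro sum.cong refl) (simp add: orthonormal_familyD[OF assms(1) _ assms(3)])
  then show ?thesis
    using assms by simp
qed

lemma orthonormal_combinations_inner:
  assumes "orthonormal_family I v" "finite I"
  shows "(\<Sum>i\<in>I. c i *\<^sub>R v i) \<bullet> (\<Sum>i\<in>I. d i *\<^sub>R v i) = (\<Sum>i\<in>I. c i * d i)"
  unfolding inner_sum_right[of _ _ I]
  by (intro sum.cong refl) (simp add: orthonormal_combination_inner[OF assms])

text \<open>The squared distance from $z$ to its projection $p$ onto the span of the family is nonnegative.\<close>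

lemma Bessel_inequality:
  fixes z :: "'a::real_inner"
  assumes "orthonormal_family I v" "finite I"
  shows "(\<Sum>i\<in>I. (v i \<bullet> z)\<^sup>2) \<le> z \<bullet> z"
proof -
  define p where "p = (\<Sum>i\<in>I. (v i \<bullet> z) *\<^sub>R v i)"
  have zp: "z \<bullet> p = (\<Sum>i\<in>I. (v i \<bullet> z)\<^sup>2)"
    by (simp add: p_def inner_sum_right power2_eq_square inner_commute)
  have pp: "p \<bullet> p = (\<Sum>i\<in>I. (v i \<bullet> z)\<^sup>2)"
    unfolding p_def orthonormal_combinations_inner[OF assms] by (simp add: power2_eq_square)
  have "0 \<le> (z - p) \<bullet> (z - p)" by simp
  also have "\<dots> = z \<bullet> z - (\<Sum>i\<in>I. (v i \<bullet> z)\<^sup>2)"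
    using zp pp by (simp add: algebra_simps inner_commute)
  finally show ?thesis by simp
qed

lemma orthonormal_family_inj_independent:
  fixes v :: "'i \<Rightarrow> 'a::euclidean_space"
  assumes on: "orthonormal_family I v"
  shows "inj_on v I" "independent (v ` I)"
proof -
  show inj: "inj_on v I"
  proof (rule inj_onI)
    fix i j assume ij: "i \<in> I" "j \<in> I" "v i = v j"
    then have "v i \<bullet> v j = 1" using orthonormal_familyD[OF on, of i i] by simp
    then show "i = j" using orthonormal_familyD[OF on ij(1,2)] by (auto split: if_splits)
  qed
  show "independent (v ` I)"
  proof (rule pairwise_orthogonal_independent)
    show "pairwise orthogonal (v ` I)"
      using on by (auto simp: pairwise_def orthogonal_def orthonormal_family_def)
    show "0 \<notin> v ` I"
      using on by (force simp: orthonormal_family_def)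
  qed
qed

lemma orthonormal_family_expand:
  fixes v :: "'i \<Rightarrow> 'a::euclidean_space"
  assumes on: "orthonormal_family I v" and fin: "finite I" and card: "card I = DIM('a)"
  shows "(\<Sum>i\<in>I. (v i \<bullet> y) *\<^sub>R v i) = y"
proof -
  note ind = orthonormal_family_inj_independent[OF on]
  have "span (v ` I) = UNIV"
    by (metis card card_image dim_eq_card_independent dim_eq_full ind)
  moreover have "pairwise orthogonal (v ` I)"
    using on by (auto simp: pairwise_def orthogonal_def orthonormal_family_def)
  moreover have "norm b = 1" if "b \<in> v ` I" for b
    using that on by (auto simp: norm_eq_1 orthonormal_family_def)
  ultimately have "(\<Sum>b\<in>v ` I. (y \<bullet> b) *\<^sub>R b) = y"
    using fin by (intro orthonormal_basis_expand) auto
  then show ?thesis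
    using ind(1) by (simp add: sum.reindex inner_commute)
qed

lemma orthonormal_family_Parseval:
  fixes v :: "'i \<Rightarrow> 'a::euclidean_space"
  assumes "orthonormal_family I v" "finite I" "card I = DIM('a)"
  shows "y \<bullet> z = (\<Sum>i\<in>I. (v i \<bullet> y) * (v i \<bullet> z))"
  using orthonormal_combinations_inner[OF assms(1,2), of "\<lambda>i. v i \<bullet> y" "\<lambda>i. v i \<bullet> z"]
  by (simp add: orthonormal_family_expand[OF assms])

text \<open>A maximiser $w$ of the Rayleigh quotient on an invariant subspace is an eigenvector. Otherwise
  $z = f(w) - (w\cdot f(w))\,w$ is a nonzero vector orthogonal to $w$, and moving from $w$ a small
  distance $t$ in the direction $z$ raises the quotient by $2t\,(z\cdot z)$ to first order.\<close>

lemma constrained_maximiser_eigenvector: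
  fixes f :: "'a::euclidean_space \<Rightarrow> 'a"
  assumes f: "linear f" and sym: "\<And>x y. x \<bullet> f y = f x \<bullet> y"
    and S: "subspace S" and inv: "\<And>x. x \<in> S \<Longrightarrow> f x \<in> S" and nontriv: "S \<noteq> {0}"
  obtains w where "w \<in> S" "w \<bullet> w = 1" "f w = (w \<bullet> f w) *\<^sub>R w"
    "\<And>u. u \<in> S \<Longrightarrow> u \<bullet> f u \<le> (w \<bullet> f w) * (u \<bullet> u)"
proof -
  obtain s where s: "s \<in> S" "s \<noteq> 0"
    using nontriv subspace_0[OF S] by blast
  have "compact (sphere 0 1 \<inter> S)"
    by (intro compact_Int_closed compact_sphere closed_subspace S)
  moreover have "(1 / norm s) *\<^sub>R s \<in> sphere 0 1 \<inter> S"
    using s S by (auto intro: subspace_scale)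
  moreover have "continuous_on (sphere 0 1 \<inter> S) (\<lambda>u. u \<bullet> f u)"
    by (intro continuous_intros linear_continuous_on linear_conv_bounded_linear[THEN iffD1] f)
  ultimately obtain w where w: "w \<in> sphere 0 1 \<inter> S"
      and max: "\<And>u. u \<in> sphere 0 1 \<inter> S \<Longrightarrow> u \<bullet> f u \<le> w \<bullet> f w"
    using continuous_attains_sup[of "sphere 0 1 \<inter> S" "\<lambda>u. u \<bullet> f u"] by blast
  define m where "m = w \<bullet> f w"
  have ww: "w \<bullet> w = 1" and wS: "w \<in> S"
    using w by (auto simp: dot_square_norm)
  have le: "u \<bullet> f u \<le> m * (u \<bullet> u)" if "u \<in> S" for u
  proof (cases "u = 0")
    case False
    have "(1 / norm u) *\<^sub>R u \<in> sphere 0 1 \<inter> S"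
      using False that S by (auto intro: subspace_scale)
    from max[OF this] show ?thesis
      using False by (simp add: linear_scale[OF f] m_def divide_simps dot_square_norm power2_eq_square)
  qed (simp add: linear_0[OF f])
  define z where "z = f w - m *\<^sub>R w"
  have zS: "z \<in> S"
    unfolding z_def by (intro subspace_diff subspace_scale S inv wS)
  have zw: "z \<bullet> w = 0"
    by (simp add: z_def inner_diff_left ww m_def inner_commute[of w "f w"])
  have zfw: "z \<bullet> f w = z \<bullet> z"
  proof -
    have "f w = z + m *\<^sub>R w" by (simp add: z_def)
    then have "z \<bullet> f w = z \<bullet> z + m * (z \<bullet> w)"
      by (simp only: inner_add_right inner_scaleR_right)
    then show ?thesis by (simp only: zw mult_zero_right add_0_right)
  qed
  define c where "c = m * (z \<bullet> z) - z \<bullet> f z"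
  have key: "2 * t * (z \<bullet> z) \<le> t\<^sup>2 * c" for t
  proof -
    have le_t: "(w + t *\<^sub>R z) \<bullet> f (w + t *\<^sub>R z) \<le> m * ((w + t *\<^sub>R z) \<bullet> (w + t *\<^sub>R z))"
      by (intro le subspace_add subspace_scale S wS zS)
    have form: "(w + t *\<^sub>R z) \<bullet> f (w + t *\<^sub>R z) = m + 2 * t * (z \<bullet> z) + t\<^sup>2 * (z \<bullet> f z)"
      using zfw sym[of w z]
      by (simp add: linear_add[OF f] linear_scale[OF f] inner_add_left inner_add_right m_def
          power2_eq_square inner_commute algebra_simps)
    have sq: "(w + t *\<^sub>R z) \<bullet> (w + t *\<^sub>R z) = 1 + t\<^sup>2 * (z \<bullet> z)"
      using zw ww by (simp add: inner_add_left inner_add_right inner_commute power2_eq_square)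
    show ?thesis
      using le_t unfolding form sq by (simp add: c_def algebra_simps)
  qed
  have "z \<bullet> z = 0"
  proof (rule ccontr)
    assume "z \<bullet> z \<noteq> 0"
    then have pos: "z \<bullet> z > 0" by simp
    \<comment> \<open>Small enough for the linear term to beat the quadratic one, whatever the sign of \<open>c\<close>.\<close>
    define t where "t = (z \<bullet> z) / (\<bar>c\<bar> + 1)"
    have t: "t > 0" using pos by (simp add: t_def)
    have "2 * (z \<bullet> z) \<le> t * c"
      using key[of t] t by (simp add: power2_eq_square mult.assoc)
    also have "\<dots> \<le> t * (\<bar>c\<bar> + 1)" using t by (intro mult_left_mono) auto
    also have "\<dots> = z \<bullet> z" by (simp add: t_def)
    finally show False using pos by simp
  qed
  then have "f w = m *\<^sub>R w" by (simp add: z_def)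
  then show thesis
    using that[of w] wS ww le by (simp add: m_def)
qed

text \<open>The eigenvectors are found one at a time by maximising over the orthogonal complement of those
  already found. The last conjunct carries the order of the eigenvalues through the induction:
  every eigenvalue found so far bounds the form on the remaining complement, hence the next
  eigenvalue.\<close>

lemma partial_eigenbasis:
  fixes f :: "'a::euclidean_space \<Rightarrow> 'a"
  assumes f: "linear f" and sym: "\<And>x y. x \<bullet> f y = f x \<bullet> y"
  shows "m \<le> DIM('a) \<Longrightarrow> \<exists>mu v. orthonormal_family {1..m} v \<and> antimono_on {1..m} mu \<and>
     (\<forall>i\<in>{1..m}. f (v i) = mu i *\<^sub>R v i) \<and>
     (\<forall>i\<in>{1..m}. \<forall>u. (\<forall>j\<in>{1..m}. v j \<bullet> u = 0) \<longrightarrow> u \<bullet> f u \<le> (mu i :: real) * (u \<bullet> u))"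
proof (induction m)
  case 0
  then show ?case by (auto simp: orthonormal_family_def monotone_on_def)
next
  case (Suc m)
  then obtain mu v where on: "orthonormal_family {1..m} v" and anti: "antimono_on {1..m} mu"
    and eig: "\<And>i. i \<in> {1..m} \<Longrightarrow> f (v i) = mu i *\<^sub>R v i"
    and bnd: "\<And>i u. i \<in> {1..m} \<Longrightarrow> (\<And>j. j \<in> {1..m} \<Longrightarrow> v j \<bullet> u = 0) \<Longrightarrow> u \<bullet> f u \<le> mu i * (u \<bullet> u)"
    by (metis Suc_leD)
  define S where "S = {u. \<forall>j\<in>{1..m}. v j \<bullet> u = 0}"
  have S: "subspace S"
    by (auto simp: S_def subspace_def inner_add_right)
  have inv: "f u \<in> S" if "u \<in> S" for u
    using that by (auto simp: S_def sym eig)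
  have "S \<noteq> {0}"
  proof
    assume S0: "S = {0}"
    \<comment> \<open>Fewer vectors than the dimension cannot span, so some nonzero vector is orthogonal to all.\<close>
    have "dim (span (v ` {1..m})) \<le> card (v ` {1..m})"
      by (simp add: dim_le_card')
    also have "\<dots> \<le> m" using card_image_le[of "{1..m}" v] by simp
    also have "\<dots> < DIM('a)" using Suc.prems by simp
    finally obtain u where u: "u \<noteq> 0" "\<And>y. y \<in> span (v ` {1..m}) \<Longrightarrow> orthogonal u y"
      using orthogonal_to_subspace_exists by (metis dim_span span_span)
    have "v j \<bullet> u = 0" if "j \<in> {1..m}" for j
      using u(2)[of "v j"] that by (simp add: orthogonal_def inner_commute span_base)
    then have "u \<in> S"
      by (simp add: S_def)
    with S0 u show False by auto
  qed
  then obtain w where w: "w \<in> S" "w \<bullet> w = 1" "f w = (w \<bullet> f w) *\<^sub>R w"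
    and wmax: "\<And>u. u \<in> S \<Longrightarrow> u \<bullet> f u \<le> (w \<bullet> f w) * (u \<bullet> u)"
    using constrained_maximiser_eigenvector[OF f sym S inv] by metis
  have set: "{1..Suc m} = insert (Suc m) {1..m}" by auto
  have w_le: "w \<bullet> f w \<le> mu i" if "i \<in> {1..m}" for i
    using bnd[OF that, of w] w by (auto simp: S_def)
  define mu' where "mu' = mu(Suc m := w \<bullet> f w)"
  define v' where "v' = v(Suc m := w)"
  have "orthonormal_family {1..Suc m} v'"
    using on w by (auto simp: orthonormal_family_def v'_def S_def inner_commute)
  moreover have "antimono_on {1..Suc m} mu'"
    using anti w_le by (auto simp: monotone_on_def mu'_def le_Suc_eq)
  moreover have "\<forall>i\<in>{1..Suc m}. f (v' i) = mu' i *\<^sub>R v' i"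
    using eig w(3) by (auto simp: mu'_def v'_def le_Suc_eq)
  moreover have "u \<bullet> f u \<le> mu' i * (u \<bullet> u)"
    if i: "i \<in> {1..Suc m}" and u: "\<forall>j\<in>{1..Suc m}. v' j \<bullet> u = 0" for i u
  proof -
    have uv: "v j \<bullet> u = 0" if "j \<in> {1..m}" for j
      using u[rule_format, of j] that by (simp add: v'_def)
    show ?thesis
    proof (cases "i = Suc m")
      case True
      have "u \<in> S" using uv by (simp add: S_def)
      from wmax[OF this] True show ?thesis by (simp add: mu'_def)
    next
      case False
      then show ?thesis using bnd[of i u] uv i by (simp add: mu'_def)
    qed
  qed
  ultimately show ?case by blast
qed

lemma outer_prod_vector_mult: "outer_prod x y *v u = (y \<bullet> u) *\<^sub>R x"
  by (simp add: outer_prod_def matrix_vector_mult_def vec_eq_iff inner_vec_def sum_distrib_left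
      mult_ac)

lemma sum_matrix_vector_mult: "(\<Sum>i\<in>I. A i) *v u = (\<Sum>i\<in>I. A i *v u)"
  for A :: "'i \<Rightarrow> real^'n^'m"
  by (induction I rule: infinite_finite_induct) (auto simp: matrix_vector_mult_add_rdistrib)

lemma spectral_decomposition_exists:
  fixes A :: "real^'n^'n"
  assumes "transpose A = A"
  shows "\<exists>mu v. spectral_decomposition A mu v"
proof -
  have sym: "x \<bullet> (A *v y) = (A *v x) \<bullet> y" for x y
    by (metis assms dot_lmul_matrix transpose_matrix_vector)
  obtain mu v where on: "orthonormal_family {1..CARD('n)} v" and anti: "antimono_on {1..CARD('n)} mu"
    and eig: "\<And>i. i \<in> {1..CARD('n)} \<Longrightarrow> A *v v i = mu i *\<^sub>R v i"
    using partial_eigenbasis[OF matrix_vector_mul_linear sym, of "CARD('n)"] by auto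
  have "A = (\<Sum>i=1..CARD('n). mu i *\<^sub>R outer_prod (v i) (v i))"
  proof (subst matrix_eq, intro allI)
    fix y :: "real^'n"
    have "A *v y = A *v (\<Sum>i=1..CARD('n). (v i \<bullet> y) *\<^sub>R v i)"
      by (subst orthonormal_family_expand[OF on]) auto
    also have "\<dots> = (\<Sum>i=1..CARD('n). (v i \<bullet> y) *\<^sub>R (A *v v i))"
      by (simp add: linear_sum[OF matrix_vector_mul_linear] linear_scale[OF matrix_vector_mul_linear])
    also have "\<dots> = (\<Sum>i=1..CARD('n). mu i *\<^sub>R outer_prod (v i) (v i)) *v y"
      by (simp add: sum_matrix_vector_mult scaleR_matrix_vector_assoc[symmetric]
          outer_prod_vector_mult eig mult.commute)
    finally show "A *v y = (\<Sum>i=1..CARD('n). mu i *\<^sub>R outer_prod (v i) (v i)) *v y" .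
  qed
  with on anti show ?thesis
    unfolding spectral_decomposition_def orthonormal_family_def by blast
qed

section \<open>The top eigenvectors leave the smallest residual\<close>

lemma spectral_decomposition_quadratic_form:
  fixes A :: "real^'n^'n"
  assumes "spectral_decomposition A mu v"
  shows "u \<bullet> (A *v u) = (\<Sum>i=1..CARD('n). mu i * (v i \<bullet> u)\<^sup>2)"
proof -
  have A: "A = (\<Sum>i=1..CARD('n). mu i *\<^sub>R outer_prod (v i) (v i))"
    using assms by (simp add: spectral_decomposition_def)
  show ?thesis
    by (subst A) (simp add: sum_matrix_vector_mult scaleR_matrix_vector_assoc[symmetric]
        outer_prod_vector_mult inner_sum_right power2_eq_square inner_commute mult_ac)
qed

lemma spectral_decomposition_eigenvalue:
  fixes A :: "real^'n^'n"
  assumes "spectral_decomposition A mu v" "j \<in> {1..CARD('n)}"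
  shows "v j \<bullet> (A *v v j) = mu j"
proof -
  have on: "orthonormal_family {1..CARD('n)} v"
    using assms(1) by (simp add: spectral_decomposition_def orthonormal_family_def)
  have "v j \<bullet> (A *v v j) = (\<Sum>i=1..CARD('n). if i = j then mu i else 0)"
    unfolding spectral_decomposition_quadratic_form[OF assms(1)]
    by (intro sum.cong refl) (simp add: orthonormal_familyD[OF on _ assms(2)])
  then show ?thesis using assms(2) by simp
qed

text \<open>Think of \<open>B\<close> as an orthonormal basis of the complement of a subspace of dimension at most $k$.
  The form, summed over \<open>B\<close>, is a weighted sum of the eigenvalues, where the weight of $v_i$ is
  the squared length of its projection onto the span of \<open>B\<close>. The weights lie between 0 and 1
  and have total at least $n-k$. The least such sum puts weight 1 on the $n-k$ smallest
  eigenvalues. The total may exceed $n-k$, and then nonnegativity of the eigenvalues is used.\<close>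

lemma Ky_Fan_residual:
  fixes A :: "real^'n^'n"
  assumes sd: "spectral_decomposition A mu v" and k: "1 \<le> k" "k \<le> CARD('n)"
    and psd: "\<And>u. 0 \<le> u \<bullet> (A *v u)"
    and B: "orthonormal_family B id" "finite B" and card: "CARD('n) - k \<le> card B"
  shows "(\<Sum>i=k+1..CARD('n). v i \<bullet> (A *v v i)) \<le> (\<Sum>b\<in>B. b \<bullet> (A *v b))"
proof -
  let ?n = "CARD('n)"
  have on: "orthonormal_family {1..?n} v" and anti: "antimono_on {1..?n} mu"
    using sd by (simp_all add: spectral_decomposition_def orthonormal_family_def)
  define w where "w i = (\<Sum>b\<in>B. (b \<bullet> v i)\<^sup>2)" for i
  have w0: "0 \<le> w i" for i by (simp add: w_def sum_nonneg)
  have w1: "w i \<le> 1" if "i \<in> {1..?n}" for i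
    using Bessel_inequality[OF B, of "v i"] orthonormal_familyD[OF on that that] by (simp add: w_def)
  have "(\<Sum>i=1..?n. w i) = (\<Sum>b\<in>B. \<Sum>i=1..?n. (v i \<bullet> b) * (v i \<bullet> b))"
    unfolding w_def by (subst sum.swap) (simp add: power2_eq_square inner_commute)
  also have "\<dots> = (\<Sum>b\<in>B. b \<bullet> b)"
    by (subst orthonormal_family_Parseval[OF on]) auto
  also have "\<dots> = card B"
    using orthonormal_familyD[OF B(1)] by simp
  finally have wsum: "(\<Sum>i=1..?n. w i) = card B" .
  have split: "(\<Sum>i=1..?n. g i) = (\<Sum>i=1..k. g i) + (\<Sum>i=k+1..?n. g i)" for g :: "nat \<Rightarrow> real"
    using k by (subst sum.union_disjoint[symmetric]) (auto intro!: sum.cong)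
  have muk: "0 \<le> mu k"
    using psd[of "v k"] spectral_decomposition_eigenvalue[OF sd, of k] k by simp
  have "(\<Sum>b\<in>B. b \<bullet> (A *v b)) = (\<Sum>i=1..?n. mu i * w i)"
    unfolding spectral_decomposition_quadratic_form[OF sd] w_def
    by (subst sum.swap) (simp add: sum_distrib_left inner_commute)
  also have "\<dots> = (\<Sum>i=1..k. mu i * w i) + (\<Sum>i=k+1..?n. mu i * w i)"
    by (rule split)
  finally have total: "(\<Sum>b\<in>B. b \<bullet> (A *v b))
     = (\<Sum>i=1..k. mu i * w i) + (\<Sum>i=k+1..?n. mu i * w i)" .
  \<comment> \<open>The threshold \<open>mu k\<close> separates the two groups: replacing every eigenvalue by it can only
    shrink what the weights add on the first \<open>k\<close> indices and enlarge what is missing on the rest.\<close>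
  have head: "(\<Sum>i=1..k. mu k * w i) \<le> (\<Sum>i=1..k. mu i * w i)"
    using anti k w0 by (intro sum_mono mult_right_mono) (auto simp: monotone_on_def)
  have tail: "(\<Sum>i=k+1..?n. mu i * (1 - w i)) \<le> (\<Sum>i=k+1..?n. mu k * (1 - w i))"
    using anti k w1 by (intro sum_mono mult_right_mono) (auto simp: monotone_on_def)
  have "(\<Sum>i=k+1..?n. 1 - w i) \<le> (\<Sum>i=1..k. w i)"
    using wsum card split[of w] k by (simp add: sum_subtractf of_nat_diff)
  then have "(\<Sum>i=k+1..?n. mu k * (1 - w i)) \<le> (\<Sum>i=1..k. mu k * w i)"
    using muk by (simp add: sum_distrib_left[symmetric] mult_left_mono)
  with head tail have "(\<Sum>i=k+1..?n. mu i * (1 - w i)) \<le> (\<Sum>i=1..k. mu i * w i)"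
    by linarith
  then have "(\<Sum>i=k+1..?n. mu i) \<le> (\<Sum>b\<in>B. b \<bullet> (A *v b))"
    using total by (simp add: algebra_simps sum_subtractf)
  moreover have "(\<Sum>i=k+1..?n. v i \<bullet> (A *v v i)) = (\<Sum>i=k+1..?n. mu i)"
    by (intro sum.cong refl spectral_decomposition_eigenvalue[OF sd]) auto
  ultimately show ?thesis by simp
qed

section \<open>Monomials, moments and powers of inner products\<close>

lemma sum_rotate:
  "(\<Sum>i\<in>A. \<Sum>j\<in>B. \<Sum>k\<in>C. f i j k) = (\<Sum>k\<in>C. \<Sum>i\<in>A. \<Sum>j\<in>B. f i j k)"
  for f :: "'i \<Rightarrow> 'j \<Rightarrow> 'k \<Rightarrow> real"
proof -
  have "(\<Sum>i\<in>A. \<Sum>j\<in>B. \<Sum>k\<in>C. f i j k) = (\<Sum>i\<in>A. \<Sum>k\<in>C. \<Sum>j\<in>B. f i j k)"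
    by (intro sum.cong refl sum.swap)
  also have "\<dots> = (\<Sum>k\<in>C. \<Sum>i\<in>A. \<Sum>j\<in>B. f i j k)"
    by (rule sum.swap)
  finally show ?thesis .
qed

lemma monomial_Cons: "monomial (a # J) X = X $ a * monomial J X"
  by (simp add: monomial_def prod.lessThan_Suc_shift del: prod.lessThan_Suc)

lemma sum_lists_Suc:
  fixes f :: "'n::finite list \<Rightarrow> real"
  shows "(\<Sum>I | length I = Suc s. f I) = (\<Sum>J | length J = s. \<Sum>a\<in>UNIV. f (a # J))"
proof -
  have "(\<Sum>J | length J = s. \<Sum>a\<in>UNIV. f (a # J))
      = (\<Sum>(J, a)\<in>{J. length J = s} \<times> UNIV. f (a # J))"
    by (simp add: sum.cartesian_product)
  also have "\<dots> = (\<Sum>I | length I = Suc s. f I)"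
    by (rule sum.reindex_bij_witness[of _ "\<lambda>I. (tl I, hd I)" "\<lambda>(J, a). a # J"])
      (auto simp: length_Suc_conv)
  finally show ?thesis by simp
qed

text \<open>The monomials of degree $s$ are the coordinates of $x^{\otimes s}$, and
  $x^{\otimes s}\cdot y^{\otimes s}=(x\cdot y)^s$.\<close>

lemma sum_monomial_mult:
  fixes x y :: "real^'n"
  shows "(\<Sum>I | length I = s. monomial I x * monomial I y) = (x \<bullet> y) ^ s"
proof (induction s)
  case 0
  then show ?case by (simp add: monomial_def)
next
  case (Suc s)
  have "(\<Sum>I | length I = Suc s. monomial I x * monomial I y)
     = (\<Sum>J | length J = s. (x \<bullet> y) * (monomial J x * monomial J y))"
    unfolding sum_lists_Suc
    by (simp add: monomial_Cons inner_vec_def sum_distrib_right sum_distrib_left mult_ac)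
  then show ?case
    using Suc by (simp add: sum_distrib_left[symmetric])
qed

lemma sum_monomial_combinations_mult:
  fixes x y :: "'i \<Rightarrow> real^'n"
  shows "(\<Sum>I | length I = s. (\<Sum>i\<in>A. c i * monomial I (x i)) * (\<Sum>j\<in>B. d j * monomial I (y j)))
    = (\<Sum>i\<in>A. \<Sum>j\<in>B. c i * d j * (x i \<bullet> y j) ^ s)"
proof -
  have "(\<Sum>I | length I = s. (\<Sum>i\<in>A. c i * monomial I (x i)) * (\<Sum>j\<in>B. d j * monomial I (y j)))
    = (\<Sum>I | length I = s. \<Sum>i\<in>A. \<Sum>j\<in>B. c i * d j * (monomial I (x i) * monomial I (y j)))"
    by (simp add: sum_product mult_ac)
  also have "\<dots> = (\<Sum>i\<in>A. \<Sum>j\<in>B. \<Sum>I | length I = s. c i * d j * (monomial I (x i) * monomial I (y j)))"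
    by (rule sum_rotate[symmetric])
  finally show ?thesis
    by (simp add: sum_distrib_left[symmetric] sum_monomial_mult)
qed

lemma continuous_monomial: "continuous_on UNIV (monomial I)"
  unfolding monomial_def by (intro continuous_intros)

lemma borel_measurable_monomial [measurable]: "monomial I \<in> borel_measurable borel"
  by (intro borel_measurable_continuous_onI continuous_monomial)

lemma empirical_map_measurable [measurable]:
  "x \<in> measurable (uniform_count_measure {1..N}) borel"
  by (simp add: measurable_def sets_uniform_count_measure space_uniform_count_measure)

lemma prob_space_empirical_measure: "1 \<le> N \<Longrightarrow> prob_space (empirical_measure N x)"
  unfolding empirical_measure_def
  by (intro prob_space.prob_space_distr prob_space_uniform_count_measure empirical_map_measurable) auto

lemma sets_empirical_measure [simp]: "sets (empirical_measure N x) = sets borel"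
  by (simp add: empirical_measure_def)

lemma finite_moments_empirical_measure: "finite_moments (empirical_measure N x)"
  unfolding finite_moments_def empirical_measure_def
  by (auto simp: integrable_distr_eq uniform_count_measure_def
      intro!: integrable_point_measure_finite)

lemma moment_empirical_measure:
  "moment (empirical_measure N x) I = (\<Sum>i=1..N. 1 / real N * monomial I (x i))"
  unfolding moment_def empirical_measure_def
  by (subst integral_distr[OF empirical_map_measurable borel_measurable_monomial])
    (simp add: integral_uniform_count_measure sum_divide_distrib)

text \<open>Contracting the first index of a moment tensor with $b$ inserts the factor $b\cdot X$ under
  the integral; it vanishes when the measure lives on a subspace orthogonal to $b$.\<close>

lemma sum_moment_Cons:
  fixes M :: "(real^'n) measure"
  assumes "\<And>a. integrable M (monomial (a # J))"
  shows "(\<Sum>a\<in>UNIV. b $ a * moment M (a # J)) = (\<integral>X. (b \<bullet> X) * monomial J X \<partial>M)"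
proof -
  have "(\<integral>X. (b \<bullet> X) * monomial J X \<partial>M) = (\<integral>X. (\<Sum>a\<in>UNIV. b $ a * monomial (a # J) X) \<partial>M)"
    by (simp add: inner_vec_def monomial_Cons sum_distrib_right mult.assoc)
  also have "\<dots> = (\<Sum>a\<in>UNIV. b $ a * moment M (a # J))"
    unfolding moment_def using assms by (subst Bochner_Integration.integral_sum) auto
  finally show ?thesis ..
qed

lemma AE_in_closed_subspace:
  assumes "prob_space M" "sets M = sets borel" "closed V"
    and "\<forall>A\<in>sets borel. measure M A = measure M (A \<inter> V)"
  shows "AE X in M. X \<in> V"
proof -
  interpret prob_space M by fact
  have sp: "space M = UNIV" using assms(2) sets_eq_imp_space_eq by fastforce
  have "prob V = 1"
    using assms(4) prob_space sp by (metis Int_UNIV_left sets.top space_borel)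
  then show ?thesis
    using assms(2,3) by (subst (asm) prob_eq_1) (auto simp: borel_closed)
qed

section \<open>The matrix as a residual quadratic form\<close>

lemma H_matrix_quadratic_form:
  fixes x :: "nat \<Rightarrow> real^'n"
  shows "u \<bullet> (H_matrix lam N x *v u) = (\<Sum>s=1..4. lam s / real CARD('n) ^ s *
    (\<Sum>i=1..N. \<Sum>j=1..N. (1 / real N * (u \<bullet> x i)) * (1 / real N * (u \<bullet> x j)) * (x i \<bullet> x j) ^ (s - 1)))"
proof -
  have "u \<bullet> (H_matrix lam N x *v u) =
    (\<Sum>i=1..N. \<Sum>j=1..N. \<Sum>s=1..4. lam s / real CARD('n) ^ s *
      ((1 / real N * (u \<bullet> x i)) * (1 / real N * (u \<bullet> x j)) * (x i \<bullet> x j) ^ (s - 1)))"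
    unfolding H_matrix_def H_kernel_def
    by (simp only: scaleR_matrix_vector_assoc[symmetric] sum_matrix_vector_mult
        outer_prod_vector_mult inner_scaleR_right inner_sum_right sum_distrib_left
        sum_distrib_right)
      (simp add: inner_commute power2_eq_square mult_ac sum_distrib_left sum_distrib_right sum_divide_distrib)
  also have "\<dots> = (\<Sum>s=1..4. \<Sum>i=1..N. \<Sum>j=1..N. lam s / real CARD('n) ^ s *
      ((1 / real N * (u \<bullet> x i)) * (1 / real N * (u \<bullet> x j)) * (x i \<bullet> x j) ^ (s - 1)))"
    by (rule sum_rotate)
  finally show ?thesis
    by (simp only: sum_distrib_left)
qed

text \<open>The form is a weighted sum of squared norms of the moment tensors contracted with $u$
  in the first index. Besides linking the matrix to the distance, this shows that the matrix
  is positive semidefinite.\<close>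

lemma H_matrix_quadratic_form_moments:
  fixes x :: "nat \<Rightarrow> real^'n"
  shows "u \<bullet> (H_matrix lam N x *v u) = (\<Sum>s=1..4. lam s / real CARD('n) ^ s *
    (\<Sum>J | length J = s - 1. (\<Sum>a\<in>UNIV. u $ a * moment (empirical_measure N x) (a # J))\<^sup>2))"
proof -
  have "(\<Sum>a\<in>UNIV. u $ a * moment (empirical_measure N x) (a # J))
      = (\<Sum>i=1..N. (1 / real N * (u \<bullet> x i)) * monomial J (x i))" for J
    unfolding moment_empirical_measure sum_distrib_left
    by (subst sum.swap) (simp add: monomial_Cons inner_vec_def sum_distrib_left sum_distrib_right
        sum_divide_distrib mult_ac)
  then show ?thesis
    unfolding H_matrix_quadratic_form power2_eq_square
    by (simp only: sum_monomial_combinations_mult)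
qed

lemma weight_nonneg:
  "\<forall>s\<in>{1..4}. lam s > (0::real) \<Longrightarrow> s \<in> {1..4::nat} \<Longrightarrow> 0 \<le> lam s / real n ^ s"
  by (auto simp: less_imp_le)

lemma H_matrix_psd:
  fixes x :: "nat \<Rightarrow> real^'n"
  assumes "\<forall>s\<in>{1..4}. lam s > 0"
  shows "0 \<le> u \<bullet> (H_matrix lam N x *v u)"
  unfolding H_matrix_quadratic_form_moments using assms
  by (intro sum_nonneg mult_nonneg_nonneg[OF weight_nonneg] zero_le_power2) auto

lemma transpose_H_matrix: "transpose (H_matrix lam N x) = H_matrix lam N x"
proof -
  have "H_matrix lam N x $ a $ b = H_matrix lam N x $ b $ a" for a b
    unfolding H_matrix_def H_kernel_def outer_prod_def
    by (simp, subst sum.swap) (simp add: inner_commute mult_ac)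
  then show ?thesis by (simp add: transpose_def vec_eq_iff)
qed

lemma d_HM_squared:
  fixes M M' :: "(real^'n) measure"
  assumes "\<forall>s\<in>{1..4}. lam s > 0"
  shows "(d_HM lam M M')\<^sup>2 = (\<Sum>s=1..4. lam s / real CARD('n) ^ s *
     (\<Sum>I | length I = s. (moment M I - moment M' I)\<^sup>2))"
  unfolding d_HM_def
  using assms
  by (intro real_sqrt_pow2 sum_nonneg mult_nonneg_nonneg[OF weight_nonneg] zero_le_power2) auto

lemma d_HM_nonneg:
  assumes "\<forall>s\<in>{1..4}. lam s > 0"
  shows "0 \<le> d_HM lam M M'"
  unfolding d_HM_def
  using assms
  by (intro real_sqrt_ge_zero sum_nonneg mult_nonneg_nonneg[OF weight_nonneg] zero_le_power2) auto

section \<open>Lower bound for every competitor\<close>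

text \<open>For \<open>b\<close> orthogonal to a set \<open>V\<close> that carries \<open>M\<close>, contracting the first index with \<open>b\<close> does not see
  the moments of \<open>M\<close>, so the data moments may be replaced by the differences of moments.
  Bessel's inequality in the first index then bounds the sum over \<open>B\<close> by the full squared norm.\<close>

lemma residual_le_d_HM_squared:
  fixes x :: "nat \<Rightarrow> real^'n"
  assumes lam: "\<forall>s\<in>{1..4}. lam s > 0"
    and fm: "finite_moments M" and V: "AE X in M. X \<in> V"
    and B: "orthonormal_family B id" "finite B" and perp: "\<And>b y. b \<in> B \<Longrightarrow> y \<in> V \<Longrightarrow> b \<bullet> y = 0"
  shows "(\<Sum>b\<in>B. b \<bullet> (H_matrix lam N x *v b)) \<le> (d_HM lam (empirical_measure N x) M)\<^sup>2"
proof -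
  let ?m = "moment (empirical_measure N x)"
  have flat: "(\<Sum>b\<in>B. \<Sum>J | length J = s - 1. (\<Sum>a\<in>UNIV. b $ a * ?m (a # J))\<^sup>2)
      \<le> (\<Sum>I | length I = s. (?m I - moment M I)\<^sup>2)" if s: "s \<in> {1..4}" for s
  proof -
    \<comment> \<open>The fibre of the moment difference tensor over the trailing indices \<open>J\<close>.\<close>
    define z where "z J = (\<chi> a. ?m (a # J) - moment M (a # J))" for J
    have "(\<Sum>a\<in>UNIV. b $ a * ?m (a # J)) = b \<bullet> z J" if b: "b \<in> B" and J: "length J = s - 1" for b J
    proof -
      have "integrable M (monomial (a # J))" for a
        using fm s J by (auto simp: finite_moments_def)
      then have "(\<Sum>a\<in>UNIV. b $ a * moment M (a # J)) = (\<integral>X. (b \<bullet> X) * monomial J X \<partial>M)"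
        by (rule sum_moment_Cons)
      also have "\<dots> = 0"
        using V by (intro integral_eq_zero_AE) (auto simp: perp[OF b])
      finally show ?thesis
        by (simp add: z_def inner_vec_def right_diff_distrib sum_subtractf)
    qed
    then have "(\<Sum>b\<in>B. \<Sum>J | length J = s - 1. (\<Sum>a\<in>UNIV. b $ a * ?m (a # J))\<^sup>2)
        = (\<Sum>b\<in>B. \<Sum>J | length J = s - 1. (b \<bullet> z J)\<^sup>2)"
      by simp
    also have "\<dots> = (\<Sum>J | length J = s - 1. \<Sum>b\<in>B. (b \<bullet> z J)\<^sup>2)"
      by (rule sum.swap)
    also have "\<dots> \<le> (\<Sum>J | length J = s - 1. z J \<bullet> z J)"
      using Bessel_inequality[OF B] by (intro sum_mono) simp
    also have "\<dots> = (\<Sum>I | length I = Suc (s - 1). (?m I - moment M I)\<^sup>2)"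
      unfolding sum_lists_Suc by (simp add: z_def inner_vec_def power2_eq_square)
    finally show ?thesis using s by simp
  qed
  have "(\<Sum>b\<in>B. b \<bullet> (H_matrix lam N x *v b)) = (\<Sum>s=1..4. lam s / real CARD('n) ^ s *
      (\<Sum>b\<in>B. \<Sum>J | length J = s - 1. (\<Sum>a\<in>UNIV. b $ a * ?m (a # J))\<^sup>2))"
    unfolding H_matrix_quadratic_form_moments by (subst sum.swap) (simp only: sum_distrib_left)
  also have "\<dots> \<le> (d_HM lam (empirical_measure N x) M)\<^sup>2"
    unfolding d_HM_squared[OF lam] using lam
    by (intro sum_mono mult_left_mono flat weight_nonneg)
  finally show ?thesis .
qed

lemma orthonormal_complement_basis:
  fixes V :: "'a::euclidean_space set"
  assumes "subspace V"
  obtains B where "orthonormal_family B id" "finite B" "card B = DIM('a) - dim V"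
    "\<And>b y. b \<in> B \<Longrightarrow> y \<in> V \<Longrightarrow> b \<bullet> y = 0"
proof -
  define W where "W = {y \<in> UNIV. \<forall>x\<in>V. orthogonal x y}"
  have W: "subspace W"
    by (auto simp: W_def subspace_def orthogonal_def inner_add_right)
  have dim: "dim W + dim V = DIM('a)"
    unfolding W_def using dim_subspace_orthogonal_to_vectors[OF assms subspace_UNIV] by simp
  obtain B where B: "B \<subseteq> W" "pairwise orthogonal B" "\<And>b. b \<in> B \<Longrightarrow> norm b = 1"
      "independent B" "card B = dim W" "span B = W"
    using orthonormal_basis_subspace[OF W] by metis
  show thesis
  proof
    show "orthonormal_family B id"
      using B(2,3) by (auto simp: orthonormal_family_def pairwise_def orthogonal_def norm_eq_1)
    show "finite B" by (rule independent_imp_finite[OF B(4)])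
    show "card B = DIM('a) - dim V" using B(5) dim by simp
    show "b \<bullet> y = 0" if "b \<in> B" "y \<in> V" for b y
      using B(1) that by (auto simp: W_def orthogonal_def inner_commute)
  qed
qed

lemma dim_span_family_le: "dim (span (v ` {1..k})) \<le> k" for v :: "nat \<Rightarrow> 'a::euclidean_space"
  using card_image_le[of "{1..k}" v] dim_le_card'[of "v ` {1..k}"] by simp

section \<open>Upper bound for the projected data\<close>

text \<open>Positive semidefiniteness of the matrix \<open>K\<close> over the index set \<open>A\<close>.\<close>

definition nonneg_kernel :: "'i set \<Rightarrow> ('i \<Rightarrow> 'i \<Rightarrow> real) \<Rightarrow> bool" where
  "nonneg_kernel A K \<longleftrightarrow> (\<forall>c. 0 \<le> (\<Sum>i\<in>A. \<Sum>j\<in>A. c i * c j * K i j))"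

lemma nonneg_kernel_const: "nonneg_kernel A (\<lambda>i j. 1)"
  unfolding nonneg_kernel_def by (simp add: sum_product[symmetric])

lemma nonneg_kernel_sum:
  assumes "nonneg_kernel A K"
  shows "0 \<le> (\<Sum>i\<in>A. \<Sum>j\<in>A. K i j)"
  using assms[unfolded nonneg_kernel_def, rule_format, of "\<lambda>_. 1"] by simp

text \<open>The Schur product theorem for one Gram factor: each coordinate of the inner product can be
  absorbed in the coefficients.\<close>

lemma nonneg_kernel_times_inner:
  fixes y :: "'i \<Rightarrow> real^'n"
  assumes "nonneg_kernel A K"
  shows "nonneg_kernel A (\<lambda>i j. (y i \<bullet> y j) * K i j)"
  unfolding nonneg_kernel_def
proof
  fix c
  have "(\<Sum>i\<in>A. \<Sum>j\<in>A. c i * c j * ((y i \<bullet> y j) * K i j))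
      = (\<Sum>i\<in>A. \<Sum>j\<in>A. \<Sum>a\<in>UNIV. (c i * y i $ a) * (c j * y j $ a) * K i j)"
    by (simp add: inner_vec_def sum_distrib_left sum_distrib_right mult_ac)
  also have "\<dots> = (\<Sum>a\<in>UNIV. \<Sum>i\<in>A. \<Sum>j\<in>A. (c i * y i $ a) * (c j * y j $ a) * K i j)"
    by (rule sum_rotate)
  also have "\<dots> \<ge> 0"
  proof (rule sum_nonneg)
    fix a :: 'n
    show "0 \<le> (\<Sum>i\<in>A. \<Sum>j\<in>A. (c i * y i $ a) * (c j * y j $ a) * K i j)"
      using assms[unfolded nonneg_kernel_def, rule_format, of "\<lambda>i. c i * y i $ a"] .
  qed
  finally show "0 \<le> (\<Sum>i\<in>A. \<Sum>j\<in>A. c i * c j * ((y i \<bullet> y j) * K i j))" .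
qed

lemma nonneg_kernel_times_inner_power:
  fixes y :: "'i \<Rightarrow> real^'n"
  assumes "nonneg_kernel A K"
  shows "nonneg_kernel A (\<lambda>i j. (y i \<bullet> y j) ^ m * K i j)"
proof (induction m)
  case (Suc m)
  from nonneg_kernel_times_inner[OF this, of y] show ?case by (simp add: mult.assoc)
qed (use assms in simp)

text \<open>Here \<open>p\<close> and \<open>r\<close> are the projected and residual parts of \<open>y\<close>. Trading one factor
  $p_i\cdot p_j$ for $y_i\cdot y_j$ adds a sum of products of Gram entries, which is nonnegative by
  the Schur product theorem. In tensor language, undoing a projection in one index cannot
  decrease the norm.\<close>

lemma residual_kernel_sum_mono:
  fixes y p r :: "'i \<Rightarrow> real^'n"
  assumes split: "\<And>i j. i \<in> A \<Longrightarrow> j \<in> A \<Longrightarrow> y i \<bullet> y j = p i \<bullet> p j + r i \<bullet> r j"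
  shows "(\<Sum>i\<in>A. \<Sum>j\<in>A. (r i \<bullet> r j) * ((y i \<bullet> y j) ^ t * (p i \<bullet> p j) ^ q))
    \<le> (\<Sum>i\<in>A. \<Sum>j\<in>A. (r i \<bullet> r j) * (y i \<bullet> y j) ^ (t + q))"
proof (induction q arbitrary: t)
  case (Suc q)
  have "nonneg_kernel A (\<lambda>i j. (r i \<bullet> r j) ^ 2 * ((y i \<bullet> y j) ^ t * ((p i \<bullet> p j) ^ q * 1)))"
    by (intro nonneg_kernel_times_inner_power nonneg_kernel_const)
  then have "0 \<le> (\<Sum>i\<in>A. \<Sum>j\<in>A. (r i \<bullet> r j) ^ 2 * ((y i \<bullet> y j) ^ t * ((p i \<bullet> p j) ^ q * 1)))"
    by (rule nonneg_kernel_sum)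
  also have "\<dots> = (\<Sum>i\<in>A. \<Sum>j\<in>A. (r i \<bullet> r j) * ((y i \<bullet> y j) ^ Suc t * (p i \<bullet> p j) ^ q)
      - (r i \<bullet> r j) * ((y i \<bullet> y j) ^ t * (p i \<bullet> p j) ^ Suc q))"
    by (intro sum.cong refl) (simp add: split algebra_simps power2_eq_square)
  finally have "(\<Sum>i\<in>A. \<Sum>j\<in>A. (r i \<bullet> r j) * ((y i \<bullet> y j) ^ t * (p i \<bullet> p j) ^ Suc q))
     \<le> (\<Sum>i\<in>A. \<Sum>j\<in>A. (r i \<bullet> r j) * ((y i \<bullet> y j) ^ Suc t * (p i \<bullet> p j) ^ q))"
    by (simp only: sum_subtractf diff_ge_0_iff_ge)
  also have "\<dots> \<le> (\<Sum>i\<in>A. \<Sum>j\<in>A. (r i \<bullet> r j) * (y i \<bullet> y j) ^ (Suc t + q))"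
    by (rule Suc.IH)
  finally show ?case by simp
qed simp

text \<open>Factoring $a^s-b^s$ with $a-b=r_i\cdot r_j$ yields $s$ terms, one for each tensor index whose
  projection is removed, and each of them is at most the residual term on the right.\<close>

lemma kernel_power_difference_le:
  fixes y p r :: "'i \<Rightarrow> real^'n"
  assumes split: "\<And>i j. i \<in> A \<Longrightarrow> j \<in> A \<Longrightarrow> y i \<bullet> y j = p i \<bullet> p j + r i \<bullet> r j"
  shows "(\<Sum>i\<in>A. \<Sum>j\<in>A. (y i \<bullet> y j) ^ s - (p i \<bullet> p j) ^ s)
    \<le> real s * (\<Sum>i\<in>A. \<Sum>j\<in>A. (r i \<bullet> r j) * (y i \<bullet> y j) ^ (s - 1))"
proof (cases s)
  case (Suc m)
  have "(\<Sum>i\<in>A. \<Sum>j\<in>A. (y i \<bullet> y j) ^ s - (p i \<bullet> p j) ^ s)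
     = (\<Sum>i\<in>A. \<Sum>j\<in>A. \<Sum>t<s. (r i \<bullet> r j) * ((y i \<bullet> y j) ^ t * (p i \<bullet> p j) ^ (m - t)))"
    unfolding Suc diff_power_eq_sum sum_distrib_left
    by (intro sum.cong refl) (simp add: split)
  also have "\<dots> = (\<Sum>t<s. \<Sum>i\<in>A. \<Sum>j\<in>A. (r i \<bullet> r j) * ((y i \<bullet> y j) ^ t * (p i \<bullet> p j) ^ (m - t)))"
    by (rule sum_rotate)
  also have "\<dots> \<le> (\<Sum>t<s. \<Sum>i\<in>A. \<Sum>j\<in>A. (r i \<bullet> r j) * (y i \<bullet> y j) ^ m)"
  proof (rule sum_mono)
    fix t assume "t \<in> {..<s}"
    then show "(\<Sum>i\<in>A. \<Sum>j\<in>A. (r i \<bullet> r j) * ((y i \<bullet> y j) ^ t * (p i \<bullet> p j) ^ (m - t)))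
        \<le> (\<Sum>i\<in>A. \<Sum>j\<in>A. (r i \<bullet> r j) * (y i \<bullet> y j) ^ m)"
      using residual_kernel_sum_mono[where t = t and q = "m - t", OF split] Suc by simp
  qed
  finally show ?thesis using Suc by simp
qed simp

lemma top_projection_vector_mult:
  "top_projection k v *v y = (\<Sum>i=1..k. (v i \<bullet> y) *\<^sub>R v i)"
  by (simp add: top_projection_def sum_matrix_vector_mult outer_prod_vector_mult)

lemma top_projection_inner:
  assumes "orthonormal_family {1..k} v"
  shows "y \<bullet> (top_projection k v *v z) = (\<Sum>i=1..k. (v i \<bullet> y) * (v i \<bullet> z))"
    and "(top_projection k v *v y) \<bullet> (top_projection k v *v z) = (\<Sum>i=1..k. (v i \<bullet> y) * (v i \<bullet> z))"
proof -
  show "y \<bullet> (top_projection k v *v z) = (\<Sum>i=1..k. (v i \<bullet> y) * (v i \<bullet> z))"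
    by (simp add: top_projection_vector_mult inner_sum_right inner_commute mult_ac)
  show "(top_projection k v *v y) \<bullet> (top_projection k v *v z) = (\<Sum>i=1..k. (v i \<bullet> y) * (v i \<bullet> z))"
    unfolding top_projection_vector_mult
    by (rule orthonormal_combinations_inner[OF assms]) simp
qed

text \<open>The projected tensors are orthogonal projections of the original ones, so the squared
  difference of the moments reduces to a difference of $s$-th powers of Gram entries. The factor
  4 is the largest tensor order.\<close>

lemma d_HM_projected_le:
  fixes x :: "nat \<Rightarrow> real^'n"
  assumes lam: "\<forall>s\<in>{1..4}. lam s > 0"
    and on: "orthonormal_family {1..CARD('n)} v" and k: "k \<le> CARD('n)"
  shows "(d_HM lam (empirical_measure N x) (empirical_measure N (\<lambda>i. top_projection k v *v x i)))\<^sup>2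
    \<le> 4 * (\<Sum>l=k+1..CARD('n). v l \<bullet> (H_matrix lam N x *v v l))"
proof -
  let ?n = "CARD('n)"
  define p where "p i = top_projection k v *v x i" for i
  define r where "r i = x i - p i" for i
  have onk: "orthonormal_family {1..k} v"
    using on k by (auto intro: orthonormal_family_mono)
  \<comment> \<open>The projection is symmetric and idempotent, so mixed Gram entries equal projected ones.\<close>
  have xp: "x i \<bullet> p j = p i \<bullet> p j" "p i \<bullet> x j = p i \<bullet> p j" for i j
  proof -
    show *: "x i \<bullet> p j = p i \<bullet> p j" for i j
      unfolding p_def top_projection_inner(2)[OF onk] by (rule top_projection_inner(1)[OF onk])
    show "p i \<bullet> x j = p i \<bullet> p j"
      using *[of j i] by (simp only: inner_commute)
  qed
  have split: "x i \<bullet> x j = p i \<bullet> p j + r i \<bullet> r j" for i j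
    by (simp add: r_def inner_diff_left inner_diff_right xp)
  have rr: "r i \<bullet> r j = (\<Sum>l=k+1..?n. (v l \<bullet> x i) * (v l \<bullet> x j))" for i j
  proof -
    have "x i \<bullet> x j = (\<Sum>l=1..?n. (v l \<bullet> x i) * (v l \<bullet> x j))"
      by (rule orthonormal_family_Parseval[OF on]) auto
    also have "\<dots> = (\<Sum>l=1..k. (v l \<bullet> x i) * (v l \<bullet> x j)) + (\<Sum>l=k+1..?n. (v l \<bullet> x i) * (v l \<bullet> x j))"
      using k by (subst sum.union_disjoint[symmetric]) (auto intro!: sum.cong)
    finally show ?thesis
      using split[of i j] top_projection_inner(2)[OF onk] by (simp add: p_def)
  qed
  define R where "R s = (\<Sum>i=1..N. \<Sum>j=1..N. (r i \<bullet> r j) * (x i \<bullet> x j) ^ (s - 1))" for s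
  have R0: "0 \<le> R s" for s
    unfolding R_def
    using nonneg_kernel_sum[OF nonneg_kernel_times_inner[OF nonneg_kernel_times_inner_power[OF nonneg_kernel_const]]]
    by (metis (no_types, lifting) mult.right_neutral sum.cong)
  have moments: "(\<Sum>I | length I = s. (moment (empirical_measure N x) I - moment (empirical_measure N p) I)\<^sup>2)
      \<le> 4 * ((1 / real N)\<^sup>2 * R s)" if s: "s \<in> {1..4}" for s
  proof -
    let ?m = "moment (empirical_measure N x)" and ?m' = "moment (empirical_measure N p)"
    have "(\<Sum>I | length I = s. (?m I - ?m' I)\<^sup>2) = (\<Sum>I | length I = s. ?m I * ?m I)
        - 2 * (\<Sum>I | length I = s. ?m I * ?m' I) + (\<Sum>I | length I = s. ?m' I * ?m' I)"
      by (simp add: power2_eq_square algebra_simps sum.distrib sum_subtractf sum_distrib_left)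
    also have "\<dots> = (\<Sum>i=1..N. \<Sum>j=1..N. (1 / real N) * (1 / real N) * (x i \<bullet> x j) ^ s)
       - 2 * (\<Sum>i=1..N. \<Sum>j=1..N. (1 / real N) * (1 / real N) * (x i \<bullet> p j) ^ s)
       + (\<Sum>i=1..N. \<Sum>j=1..N. (1 / real N) * (1 / real N) * (p i \<bullet> p j) ^ s)"
      by (simp only: moment_empirical_measure sum_monomial_combinations_mult)
    also have "\<dots> = (1 / real N)\<^sup>2 * (\<Sum>i=1..N. \<Sum>j=1..N. (x i \<bullet> x j) ^ s - (p i \<bullet> p j) ^ s)"
      by (simp add: xp sum_distrib_left sum_subtractf power2_eq_square right_diff_distrib)
    also have "\<dots> \<le> (1 / real N)\<^sup>2 * (real s * R s)"
      unfolding R_def using kernel_power_difference_le[OF split] by (intro mult_left_mono) auto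
    also have "\<dots> \<le> (1 / real N)\<^sup>2 * (4 * R s)"
      using s R0 by (intro mult_left_mono mult_right_mono) auto
    finally show ?thesis by simp
  qed
  have "(\<Sum>l=k+1..?n. v l \<bullet> (H_matrix lam N x *v v l))
     = (\<Sum>s=1..4. lam s / real ?n ^ s * (\<Sum>l=k+1..?n. \<Sum>i=1..N. \<Sum>j=1..N.
        (1 / real N * (v l \<bullet> x i)) * (1 / real N * (v l \<bullet> x j)) * (x i \<bullet> x j) ^ (s - 1)))"
    unfolding H_matrix_quadratic_form by (subst sum.swap) (simp only: sum_distrib_left)
  also have "\<dots> = (\<Sum>s=1..4. lam s / real ?n ^ s * ((1 / real N)\<^sup>2 * R s))"
  proof (intro sum.cong refl arg_cong2[where f = "(*)"])
    fix s :: nat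
    have "(\<Sum>l=k+1..?n. \<Sum>i=1..N. \<Sum>j=1..N.
        (1 / real N * (v l \<bullet> x i)) * (1 / real N * (v l \<bullet> x j)) * (x i \<bullet> x j) ^ (s - 1))
      = (\<Sum>i=1..N. \<Sum>j=1..N. \<Sum>l=k+1..?n.
        (1 / real N * (v l \<bullet> x i)) * (1 / real N * (v l \<bullet> x j)) * (x i \<bullet> x j) ^ (s - 1))"
      by (rule sum_rotate[symmetric])
    also have "\<dots> = (1 / real N)\<^sup>2 * R s"
      unfolding R_def rr sum_distrib_left sum_distrib_right
      by (intro sum.cong refl) (simp add: power2_eq_square)
    finally show "(\<Sum>l=k+1..?n. \<Sum>i=1..N. \<Sum>j=1..N.
        (1 / real N * (v l \<bullet> x i)) * (1 / real N * (v l \<bullet> x j)) * (x i \<bullet> x j) ^ (s - 1))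
       = (1 / real N)\<^sup>2 * R s" .
  qed
  finally have res: "(\<Sum>l=k+1..?n. v l \<bullet> (H_matrix lam N x *v v l))
     = (\<Sum>s=1..4. lam s / real ?n ^ s * ((1 / real N)\<^sup>2 * R s))" .
  have "(d_HM lam (empirical_measure N x) (empirical_measure N p))\<^sup>2
     \<le> (\<Sum>s=1..4. lam s / real ?n ^ s * (4 * ((1 / real N)\<^sup>2 * R s)))"
    unfolding d_HM_squared[OF lam] using lam
    by (intro sum_mono mult_left_mono moments weight_nonneg)
  also have "\<dots> = 4 * (\<Sum>s=1..4. lam s / real ?n ^ s * ((1 / real N)\<^sup>2 * R s))"
    by (simp only: sum_distrib_left mult.left_commute)
  finally show ?thesis
    unfolding res p_def .
qed

section \<open>The approximation guarantee\<close>

lemma empirical_measure_low_rank: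
  assumes "1 \<le> N" and "\<And>i. y i \<in> span (v ` {1..k})"
  shows "empirical_measure N y \<in> low_rank_measures k"
proof -
  let ?V = "span (v ` {1..k})"
  have "measure (empirical_measure N y) A = measure (empirical_measure N y) (A \<inter> ?V)"
    if A: "A \<in> sets borel" for A
  proof -
    have AV: "A \<inter> ?V \<in> sets borel"
      using A by (rule sets.Int) (rule borel_closed[OF closed_span])
    have "y -` A = y -` (A \<inter> ?V)" using assms(2) by auto
    then show ?thesis
      unfolding empirical_measure_def
      by (simp only: measure_distr[OF empirical_map_measurable A]
          measure_distr[OF empirical_map_measurable AV])
  qed
  then show ?thesis
    unfolding low_rank_measures_def
    using prob_space_empirical_measure[OF assms(1)] sets_empirical_measure by blast
qed

text \<open>The three residual estimates are chained for an arbitrary competitor \<open>M\<close>. The basis \<open>B\<close> spans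
  the orthogonal complement of the subspace that carries \<open>M\<close>.\<close>

lemma procedure_output_approximating:
  fixes x :: "nat \<Rightarrow> real^'n"
  assumes k: "1 \<le> k" "k \<le> CARD('n)" and N: "1 \<le> N"
    and lam: "\<forall>s\<in>{1..4}. lam s > 0"
    and out: "procedure_output lam k N x M'"
  shows "approximating_solution 2 lam k (empirical_measure N x) M'"
proof -
  let ?d = "d_HM lam (empirical_measure N x)"
  obtain mu v where sd: "spectral_decomposition (H_matrix lam N x) mu v"
    and M': "M' = empirical_measure N (\<lambda>i. top_projection k v *v x i)"
    using out by (auto simp: procedure_output_def)
  have on: "orthonormal_family {1..CARD('n)} v"
    using sd by (simp add: spectral_decomposition_def orthonormal_family_def)
  have low: "M' \<in> low_rank_measures k"
    unfolding M' top_projection_vector_mult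
    by (intro empirical_measure_low_rank[OF N, of _ v] span_sum span_scale span_base) auto
  have fm: "finite_moments M'"
    unfolding M' by (rule finite_moments_empirical_measure)
  have "?d M' / 2 \<le> ?d M" if M: "M \<in> low_rank_measures k" "finite_moments M" for M
  proof -
    obtain w where "prob_space M" "sets M = sets borel"
      and "\<forall>A\<in>sets borel. measure M A = measure M (A \<inter> span (w ` {1..k}))"
      using M(1) unfolding low_rank_measures_def by blast
    then have V: "AE X in M. X \<in> span (w ` {1..k})"
      by (rule AE_in_closed_subspace[OF _ _ closed_span])
    obtain B where B: "orthonormal_family B id" "finite B"
        "card B = CARD('n) - dim (span (w ` {1..k}))"
        "\<And>b y. b \<in> B \<Longrightarrow> y \<in> span (w ` {1..k}) \<Longrightarrow> b \<bullet> y = 0"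
      using orthonormal_complement_basis[OF subspace_span, of "w ` {1..k}"] by auto
    have card: "CARD('n) - k \<le> card B"
      unfolding B(3) using dim_span_family_le[of w k] by (rule diff_le_mono2)
    have "(?d M')\<^sup>2 \<le> 4 * (\<Sum>l=k+1..CARD('n). v l \<bullet> (H_matrix lam N x *v v l))"
      unfolding M' by (rule d_HM_projected_le[OF lam on k(2)])
    also have "\<dots> \<le> 4 * (\<Sum>b\<in>B. b \<bullet> (H_matrix lam N x *v b))"
      using Ky_Fan_residual[OF sd k H_matrix_psd[OF lam] B(1,2) card] by simp
    also have "\<dots> \<le> 4 * (?d M)\<^sup>2"
      using residual_le_d_HM_squared[OF lam M(2) V B(1,2,4)] by simp
    also have "\<dots> = (2 * ?d M)\<^sup>2" by (simp add: power_mult_distrib)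
    finally have "?d M' \<le> 2 * ?d M"
      by (rule power2_le_imp_le) (simp add: d_HM_nonneg[OF lam])
    then show ?thesis by simp
  qed
  then have "?d M' / 2 \<le> (INF M \<in> {M \<in> low_rank_measures k. finite_moments M}. ?d M)"
    using low fm by (intro cINF_greatest) auto
  then show ?thesis
    using low fm by (simp add: approximating_solution_def)
qed

theorem corollary1:
  fixes x :: "nat \<Rightarrow> real^'n" and lam :: "nat \<Rightarrow> real" and k N :: nat
  assumes "1 \<le> k" and "k \<le> CARD('n)"
    and "1 \<le> N"
    and "\<And>s. s \<in> {1..4} \<Longrightarrow> lam s > 0"
  shows "(\<forall>M'. procedure_output lam k N x M' \<longrightarrow>
            approximating_solution 2 lam k (empirical_measure N x) M') \<and>
         (\<exists>M'. procedure_output lam k N x M' \<and>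
            approximating_solution 2 lam k (empirical_measure N x) M')"
proof -
  have "\<exists>M'. procedure_output lam k N x M'"
    using spectral_decomposition_exists[OF transpose_H_matrix, of lam N x]
    by (auto simp: procedure_output_def)
  then show ?thesis
    using procedure_output_approximating[OF assms(1-3), of lam x] assms(4) by blast
qed

end
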